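(* Let $F$ be a field with a valuation $v$ and valuation ring $O_v$, let $E/F$ be a finite field extension, and let $w$ be a quasi-valuation on $E$ extending $v$. Then $O_w=\{x\in E\mid w(x)\ge0\}$ satisfies GD (going down) over $O_v$: for any prime ideals $P_0\subseteq P_1$ of $O_v$ and every prime ideal $Q_1$ of $O_w$ with $Q_1\cap O_v=P_1$ there is a prime ideal $Q_0\subseteq Q_1$ of $O_w$ with $Q_0\cap O_v=P_0$.
   Context: A totally ordered abelian monoid is a commutative monoid $(M,+)$ with a total order such that $a\le b$ implies $a+c\le b+c$. One adjoins $\infty$, greater than all elements of $M$, with $m+\infty=\infty$. A quasi-valuation on a ring $A$ is a function $w:A\to M\cup\{\infty\}$, $M$ a totally ordered abelian monoid, with $w(0)=\infty$, $w(xy)\ge w(x)+w(y)$ and $w(x+y)\ge\min\{w(x),w(y)\}$ for all $x,y\in A$. $w$ extends $v$ means that the value group $\Gamma_v$ of $v$ is contained in $M$ as an ordered submonoid and $w|_F=v$. *)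

theory Defs
  imports "HOL-Algebra.Embedded_Algebras"
begin

section \<open>Adjoining a greatest, absorbing element\<close>

datatype 'a with_inf = Fin 'a | PInf

instantiation with_inf :: (linorder) linorder
begin

fun less_eq_with_inf :: "'a with_inf \<Rightarrow> 'a with_inf \<Rightarrow> bool" where
  "Fin a \<le> Fin b \<longleftrightarrow> a \<le> b"
| "x \<le> PInf \<longleftrightarrow> True"
| "PInf \<le> Fin b \<longleftrightarrow> False"

definition less_with_inf :: "'a with_inf \<Rightarrow> 'a with_inf \<Rightarrow> bool" where
  "x < y \<longleftrightarrow> x \<le> y \<and> \<not> y \<le> (x :: 'a with_inf)"

instance
proof
  fix x y z :: "'a with_inf"
  show "x < y \<longleftrightarrow> x \<le> y \<and> \<not> y \<le> x" by (rule less_with_inf_def)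
  show "x \<le> x" by (cases x) auto
  show "x \<le> y \<Longrightarrow> y \<le> z \<Longrightarrow> x \<le> z" by (cases x; cases y; cases z) auto
  show "x \<le> y \<Longrightarrow> y \<le> x \<Longrightarrow> x = y" by (cases x; cases y) auto
  show "x \<le> y \<or> y \<le> x" by (cases x; cases y) auto
qed

end

instantiation with_inf :: (comm_monoid_add) comm_monoid_add
begin

definition zero_with_inf :: "'a with_inf" where
  "0 = Fin 0"

fun plus_with_inf :: "'a with_inf \<Rightarrow> 'a with_inf \<Rightarrow> 'a with_inf" where
  "Fin a + Fin b = Fin (a + b)"
| "PInf + y = PInf"
| "Fin a + PInf = PInf"

instance
proof
  fix x y z :: "'a with_inf"
  show "x + y + z = x + (y + z)" by (cases x; cases y; cases z) (auto simp: add.assoc)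
  show "x + y = y + x" by (cases x; cases y) (auto simp: add.commute)
  show "0 + x = x" by (cases x) (auto simp: zero_with_inf_def)
qed

end

instance with_inf :: ("{linorder, ordered_comm_monoid_add}") ordered_comm_monoid_add
proof
  fix x y z :: "'a with_inf"
  show "x \<le> y \<Longrightarrow> z + x \<le> z + y"
    by (cases x; cases y; cases z) (auto intro: add_left_mono)
qed


section \<open>Valuations and quasi-valuations\<close>

text \<open>
  The type of values may be larger than the set of values actually attained;
  the value group is the latter set, see \<open>value_group\<close> below.
\<close>

locale valuation = field F for F (structure) +
  fixes v :: "'a \<Rightarrow> 'g :: linordered_ab_group_add with_inf"
  assumes v_inf_iff: "x \<in> carrier F \<Longrightarrow> v x = PInf \<longleftrightarrow> x = \<zero>"
    and v_mult: "\<lbrakk>x \<in> carrier F; y \<in> carrier F\<rbrakk> \<Longrightarrow> v (x \<otimes> y) = v x + v y"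
    and v_add: "\<lbrakk>x \<in> carrier F; y \<in> carrier F\<rbrakk> \<Longrightarrow> v (x \<oplus> y) \<ge> min (v x) (v y)"

definition value_group :: "('a, 'b) ring_scheme \<Rightarrow> ('a \<Rightarrow> 'g with_inf) \<Rightarrow> 'g set" where
  "value_group F v = {g. \<exists>x \<in> carrier F - {\<zero>\<^bsub>F\<^esub>}. v x = Fin g}"

locale quasi_valuation = ring A for A (structure) +
  fixes w :: "'a \<Rightarrow> 'm :: {linorder, ordered_comm_monoid_add} with_inf"
  assumes w_zero: "w \<zero> = PInf"
    and w_mult: "\<lbrakk>x \<in> carrier A; y \<in> carrier A\<rbrakk> \<Longrightarrow> w (x \<otimes> y) \<ge> w x + w y"
    and w_add: "\<lbrakk>x \<in> carrier A; y \<in> carrier A\<rbrakk> \<Longrightarrow> w (x \<oplus> y) \<ge> min (w x) (w y)"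

text \<open>
  The values of \<open>v\<close> and \<open>w\<close> live in different types, so the inclusion of the value group
  of \<open>v\<close> in \<open>M\<close> as an ordered submonoid is an order-reflecting monoid embedding \<open>\<iota>\<close>.
\<close>

definition extends_valuation ::
    "('a, 'b) ring_scheme \<Rightarrow> ('a \<Rightarrow> 'g :: linordered_ab_group_add with_inf) \<Rightarrow>
     ('a \<Rightarrow> 'm :: {linorder, ordered_comm_monoid_add} with_inf) \<Rightarrow> bool" where
  "extends_valuation F v w \<longleftrightarrow>
     (\<exists>\<iota>. \<iota> 0 = 0
        \<and> (\<forall>a \<in> value_group F v. \<forall>b \<in> value_group F v. \<iota> (a + b) = \<iota> a + \<iota> b)
        \<and> (\<forall>a \<in> value_group F v. \<forall>b \<in> value_group F v. \<iota> a \<le> \<iota> b \<longleftrightarrow> a \<le> b)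
        \<and> (\<forall>x \<in> carrier F. w x = map_with_inf \<iota> (v x)))"

definition nonneg_ring ::
    "('a, 'b) ring_scheme \<Rightarrow> ('a \<Rightarrow> 'm :: {linorder, comm_monoid_add} with_inf) \<Rightarrow>
     ('a, 'b) ring_scheme" where
  "nonneg_ring A w = A\<lparr>carrier := {x \<in> carrier A. 0 \<le> w x}\<rparr>"


section \<open>Going down\<close>

definition going_down :: "('a, 'b) ring_scheme \<Rightarrow> ('a, 'b) ring_scheme \<Rightarrow> bool" where
  "going_down A B \<longleftrightarrow>
     (\<forall>P\<^sub>0 P\<^sub>1 Q\<^sub>1. primeideal P\<^sub>0 A \<and> primeideal P\<^sub>1 A \<and> P\<^sub>0 \<subseteq> P\<^sub>1
          \<and> primeideal Q\<^sub>1 B \<and> Q\<^sub>1 \<inter> carrier A = P\<^sub>1 \<longrightarrow>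
        (\<exists>Q\<^sub>0. primeideal Q\<^sub>0 B \<and> Q\<^sub>0 \<subseteq> Q\<^sub>1 \<and> Q\<^sub>0 \<inter> carrier A = P\<^sub>0))"


section \<open>The nonnegative parts are subrings\<close>

lemma (in valuation) v_one: "v \<one> = 0"
proof -
  obtain a where a: "v \<one> = Fin a"
    using v_inf_iff[of \<one>] by (cases "v \<one>") auto
  then show ?thesis
    using v_mult[of \<one> \<one>] by (simp add: zero_with_inf_def)
qed

lemma (in valuation) v_minus_one: "v (\<ominus> \<one>) = 0"
proof -
  obtain a where a: "v (\<ominus> \<one>) = Fin a"
    using v_inf_iff[of "\<ominus> \<one>"] by (cases "v (\<ominus> \<one>)") (auto simp: minus_equality)
  have "\<ominus> \<one> \<otimes> \<ominus> \<one> = \<one>"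
    by (simp add: l_minus r_minus)
  then show ?thesis
    using v_mult[of "\<ominus> \<one>" "\<ominus> \<one>"] v_one a by (simp add: zero_with_inf_def)
qed

lemma (in quasi_valuation) subring_nonneg:
  assumes "w \<one> = 0" and "w (\<ominus> \<one>) = 0"
  shows "subring (carrier (nonneg_ring A w)) A"
proof (rule subringI)
  show "carrier (nonneg_ring A w) \<subseteq> carrier A"
    and "\<one> \<in> carrier (nonneg_ring A w)"
    using assms by (auto simp: nonneg_ring_def)
next
  fix x assume x: "x \<in> carrier (nonneg_ring A w)"
  then have "w (\<ominus> \<one>) + w x \<le> w (\<ominus> \<one> \<otimes> x)"
    by (intro w_mult) (auto simp: nonneg_ring_def)
  with x assms show "\<ominus> x \<in> carrier (nonneg_ring A w)"
    by (auto simp: nonneg_ring_def l_minus)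
next
  fix x y assume xy: "x \<in> carrier (nonneg_ring A w)" "y \<in> carrier (nonneg_ring A w)"
  then have "w x + w y \<le> w (x \<otimes> y)" "min (w x) (w y) \<le> w (x \<oplus> y)"
    by (auto simp: nonneg_ring_def intro: w_mult w_add)
  moreover have "0 \<le> w x + w y" "0 \<le> min (w x) (w y)"
    using xy by (auto simp: nonneg_ring_def)
  ultimately have "0 \<le> w (x \<otimes> y)" "0 \<le> w (x \<oplus> y)"
    by (blast intro: order_trans)+
  then show "x \<otimes> y \<in> carrier (nonneg_ring A w)"
    and "x \<oplus> y \<in> carrier (nonneg_ring A w)"
    using xy by (auto simp: nonneg_ring_def)
qed

lemma extends_valuation_nonneg_iff:
  assumes "valuation F v" and "extends_valuation F v w" and x: "x \<in> carrier F"
  shows "0 \<le> w x \<longleftrightarrow> 0 \<le> v x"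
proof -
  interpret valuation F v by fact
  obtain \<iota> where \<iota>: "\<iota> 0 = 0" "\<forall>x \<in> carrier F. w x = map_with_inf \<iota> (v x)"
      "\<forall>a \<in> value_group F v. \<forall>b \<in> value_group F v. \<iota> a \<le> \<iota> b \<longleftrightarrow> a \<le> b"
    using assms(2) unfolding extends_valuation_def by blast
  have zero: "0 \<in> value_group F v"
    unfolding value_group_def
    using v_one by (intro CollectI bexI[of _ "\<one>\<^bsub>F\<^esub>"]) (simp_all add: zero_with_inf_def)
  show ?thesis
  proof (cases "v x")
    case (Fin a)
    then have "a \<in> value_group F v"
      using x v_inf_iff[OF x] by (auto simp: value_group_def)
    then have "\<iota> 0 \<le> \<iota> a \<longleftrightarrow> 0 \<le> a"
      using \<iota>(3) zero by blast
    moreover have "w x = Fin (\<iota> a)"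
      using bspec[OF \<iota>(2) x] Fin by simp
    ultimately show ?thesis
      by (simp only: Fin \<iota>(1) zero_with_inf_def less_eq_with_inf.simps)
  next
    case PInf
    then show ?thesis
      using bspec[OF \<iota>(2) x] by simp
  qed
qed

end

theory Submission
  imports Defs "HOL-Algebra.Ring_Divisibility"
begin

text \<open>
  Only the inclusion of the valuation ring \<open>O\<^sub>v\<close> in the domain \<open>O\<^sub>w\<close> matters. Since the
  principal ideals of \<open>O\<^sub>v\<close> form a chain, every element of \<open>P\<^sub>0O\<^sub>w\<close> has the form \<open>pb\<close> with
  \<open>p \<in> P\<^sub>0\<close> and \<open>b \<in> O\<^sub>w\<close>. If \<open>st = pb\<close> with \<open>s \<in> O\<^sub>v - P\<^sub>0\<close>, then \<open>p = sc\<close> for some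
  \<open>c \<in> P\<^sub>0\<close>, and cancelling \<open>s\<close> gives \<open>t = cb \<in> P\<^sub>0O\<^sub>w \<subseteq> Q\<^sub>1\<close>. Hence \<open>P\<^sub>0O\<^sub>w\<close> is disjoint from
  the multiplicative set \<open>(O\<^sub>v - P\<^sub>0)(O\<^sub>w - Q\<^sub>1)\<close>, and any prime ideal that contains the former
  and avoids the latter serves as \<open>Q\<^sub>0\<close>.
\<close>

text \<open>Krull's argument: Zorn's lemma gives an ideal \<open>M\<close> that is maximal among
  those containing \<open>I\<close> and disjoint from \<open>S\<close>. Such an ideal is prime,
  because two elements outside \<open>M\<close> generate, together with \<open>M\<close>, two ideals
  that meet \<open>S\<close>, and \<open>S\<close> is closed under products.\<close>

lemma (in cring) exists_primeideal_avoiding_submonoid: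
  assumes I: "ideal I R" and S: "submonoid S R" and disj: "I \<inter> S = {}"
  shows "\<exists>P. primeideal P R \<and> I \<subseteq> P \<and> P \<inter> S = {}"
proof -
  interpret S: submonoid S R by fact
  define \<A> where "\<A> = {J. ideal J R \<and> I \<subseteq> J \<and> J \<inter> S = {}}"
  have "\<exists>M\<in>\<A>. \<forall>J\<in>\<A>. M \<subseteq> J \<longrightarrow> J = M"
  proof (rule subset_Zorn_nonempty)
    show "\<A> \<noteq> {}"
      using I disj unfolding \<A>_def by blast
    fix C assume C: "C \<noteq> {}" "subset.chain \<A> C"
    then have "subset.chain {J. ideal J R} C"
      unfolding subset_chain_def \<A>_def by blast
    from chain_Union_is_ideal[OF this] have "ideal (\<Union>C) R"
      using C(1) by simp
    moreover have "I \<subseteq> \<Union>C" "\<Union>C \<inter> S = {}"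
      using C unfolding subset_chain_def \<A>_def by blast+
    ultimately show "\<Union>C \<in> \<A>"
      unfolding \<A>_def by blast
  qed
  then obtain M where MA: "M \<in> \<A>" and M_max: "\<And>J. J \<in> \<A> \<Longrightarrow> M \<subseteq> J \<Longrightarrow> J = M"
    by blast
  have M: "ideal M R" "I \<subseteq> M" "M \<inter> S = {}"
    using MA by (auto simp: \<A>_def)
  have max: "J = M" if "ideal J R" "M \<subseteq> J" "J \<inter> S = {}" for J
    using that M(2) M_max[of J] by (auto simp: \<A>_def)
  interpret M: ideal M R by fact
  \<comment> \<open>By maximality, \<open>M\<close> plus the principal ideal of \<open>a\<close>,
    being strictly larger than \<open>M\<close>, cannot be disjoint from \<open>S\<close>.\<close>
  have meets: "\<exists>m\<in>M. \<exists>x\<in>carrier R. m \<oplus> x \<otimes> a \<in> S" if a: "a \<in> carrier R" "a \<notin> M" for a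
  proof -
    let ?J = "M <+>\<^bsub>R\<^esub> PIdl a"
    have J: "m \<oplus> x \<otimes> a \<in> ?J" if "m \<in> M" "x \<in> carrier R" for m x
      using that unfolding set_add_def' cgenideal_def by blast
    have "M \<subseteq> ?J"
    proof
      fix m assume "m \<in> M"
      then show "m \<in> ?J"
        using J[of m \<zero>] a(1) by simp
    qed
    moreover have "a \<in> ?J"
      using J[of \<zero> \<one>] a(1) additive_subgroup.zero_closed[OF M.is_additive_subgroup] by simp
    ultimately have "?J \<inter> S \<noteq> {}"
      using max[OF add_ideals[OF M(1) cgenideal_ideal[OF a(1)]]] a(2) by metis
    then obtain s where "s \<in> ?J" "s \<in> S"
      by blast
    then show ?thesis
      unfolding set_add_def' cgenideal_def by blast
  qed
  have "primeideal M R"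
  proof (rule primeidealI[OF M(1) is_cring])
    show "carrier R \<noteq> M"
      using M(3) S.one_closed by auto
    fix a b assume ab: "a \<in> carrier R" "b \<in> carrier R" "a \<otimes> b \<in> M"
    show "a \<in> M \<or> b \<in> M"
    proof (rule ccontr)
      assume "\<not> (a \<in> M \<or> b \<in> M)"
      then obtain m x n y where
        mx: "m \<in> M" "x \<in> carrier R" "m \<oplus> x \<otimes> a \<in> S" and
        ny: "n \<in> M" "y \<in> carrier R" "n \<oplus> y \<otimes> b \<in> S"
        using meets[OF ab(1)] meets[OF ab(2)] by blast
      have mn: "m \<in> carrier R" "n \<in> carrier R"
        using mx ny M.Icarr by auto
      \<comment> \<open>Every summand of the expansion has a factor \<open>m\<close>,
        \<open>n\<close> or \<open>a \<otimes> b\<close>, all of which lie in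
        \<open>M\<close>.\<close>
      have "(m \<oplus> x \<otimes> a) \<otimes> (n \<oplus> y \<otimes> b)
          = m \<otimes> (n \<oplus> y \<otimes> b) \<oplus> (n \<otimes> (x \<otimes> a) \<oplus> (x \<otimes> y) \<otimes> (a \<otimes> b))"
        using mx(2) ny(2) mn ab by algebra
      also have "\<dots> \<in> M"
        using mx(1,2) ny(1,2) mn ab
        by (simp add: additive_subgroup.a_closed[OF M.is_additive_subgroup] M.I_r_closed M.I_l_closed)
      finally show False
        using M(3) S.m_closed[OF mx(3) ny(3)] by blast
    qed
  qed
  with M show ?thesis
    by blast
qed

text \<open>The valuation enters only through \<open>total\<close>: divisibility in \<open>A\<close>
  is a total relation. In the application \<open>A\<close> is the valuation ring and
  \<open>R\<close> is the ring of the quasi-valuation.\<close>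

lemma (in domain) going_down_of_total_divides:
  assumes A: "subring A R"
    and total: "\<And>a b. \<lbrakk>a \<in> A; b \<in> A\<rbrakk> \<Longrightarrow> (\<exists>c\<in>A. a = b \<otimes> c) \<or> (\<exists>c\<in>A. b = a \<otimes> c)"
  shows "going_down (R\<lparr>carrier := A\<rparr>) R"
  unfolding going_down_def
proof (intro allI impI, elim conjE)
  fix P\<^sub>0 P\<^sub>1 Q\<^sub>1
  assume P0: "primeideal P\<^sub>0 (R\<lparr>carrier := A\<rparr>)" and sub: "P\<^sub>0 \<subseteq> P\<^sub>1"
    and Q1: "primeideal Q\<^sub>1 R" and P1: "Q\<^sub>1 \<inter> carrier (R\<lparr>carrier := A\<rparr>) = P\<^sub>1"
  interpret P0: primeideal P\<^sub>0 "R\<lparr>carrier := A\<rparr>" by fact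
  interpret Q1: primeideal Q\<^sub>1 R by fact
  note AR = subringE(1)[OF A] and A_one = subringE(3)[OF A] and A_mult = subringE(6)[OF A]
  have P0A: "P\<^sub>0 \<subseteq> A" and zero_P0: "\<zero> \<in> P\<^sub>0"
    using P0.a_subset additive_subgroup.zero_closed[OF P0.is_additive_subgroup] by auto
  then have P0_ne: "P\<^sub>0 \<noteq> {}"
    by blast
  have P0_prime: "a \<in> P\<^sub>0 \<or> b \<in> P\<^sub>0" if "a \<in> A" "b \<in> A" "a \<otimes> b \<in> P\<^sub>0" for a b
    using P0.I_prime that by simp
  have one_P0: "\<one> \<notin> P\<^sub>0"
    using P0.one_imp_carrier P0.I_notcarr by auto
  have one_Q1: "\<one> \<notin> Q\<^sub>1"
    using Q1.one_imp_carrier Q1.I_notcarr by auto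
  \<comment> \<open>\<open>?I\<close> is the extension of \<open>P\<^sub>0\<close> to
    \<open>R\<close>. A union suffices in place of a sum, since by \<open>total\<close> the
    principal ideals form a chain. The two factors in \<open>?S\<close> will force
    \<open>Q\<^sub>0 \<inter> A \<subseteq> P\<^sub>0\<close> and
    \<open>Q\<^sub>0 \<subseteq> Q\<^sub>1\<close>.\<close>
  let ?I = "\<Union>p\<in>P\<^sub>0. PIdl p"
  let ?S = "{s \<otimes> t | s t. s \<in> A - P\<^sub>0 \<and> t \<in> carrier R - Q\<^sub>1}"
  have PIdl_mono: "PIdl (b \<otimes> c) \<subseteq> PIdl b" if "b \<in> A" "c \<in> A" for b c
    using that AR cgenideal_ideal cgenideal_self
    by (intro cgenideal_minimal ideal.I_r_closed) auto
  have "subset.chain {J. ideal J R} (cgenideal R ` P\<^sub>0)"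
    unfolding subset_chain_def
  proof (intro conjI ballI)
    show "cgenideal R ` P\<^sub>0 \<subseteq> {J. ideal J R}"
      using cgenideal_ideal P0A AR by auto
    fix X Y assume "X \<in> cgenideal R ` P\<^sub>0" "Y \<in> cgenideal R ` P\<^sub>0"
    then obtain p q where "p \<in> A" "q \<in> A" "X = PIdl p" "Y = PIdl q"
      using P0A by auto
    then show "X \<subseteq> Y \<or> Y \<subseteq> X"
      using total[of p q] PIdl_mono by auto
  qed
  from chain_Union_is_ideal[OF this] have "ideal ?I R"
    using P0_ne by simp
  moreover have "submonoid ?S R"
  proof
    show "?S \<subseteq> carrier R"
      using AR by auto
    have "\<one> = \<one> \<otimes> \<one>"
      by simp
    then show "\<one> \<in> ?S"
      using one_P0 one_Q1 A_one by blast
    fix x y assume "x \<in> ?S" "y \<in> ?S"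
    then obtain s t s' t' where *: "x = s \<otimes> t" "s \<in> A - P\<^sub>0" "t \<in> carrier R - Q\<^sub>1"
      "y = s' \<otimes> t'" "s' \<in> A - P\<^sub>0" "t' \<in> carrier R - Q\<^sub>1"
      by blast
    then have "s \<otimes> s' \<in> A - P\<^sub>0" "t \<otimes> t' \<in> carrier R - Q\<^sub>1"
      using P0_prime Q1.I_prime A_mult by auto
    moreover have "x \<otimes> y = (s \<otimes> s') \<otimes> (t \<otimes> t')"
    proof -
      have "s \<in> carrier R" "s' \<in> carrier R" "t \<in> carrier R" "t' \<in> carrier R"
        using * AR by auto
      then show ?thesis
        unfolding *(1,4) by algebra
    qed
    ultimately show "x \<otimes> y \<in> ?S"
      by blast
  qed
  moreover have "?I \<inter> ?S = {}"
  proof (rule ccontr)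
    assume "?I \<inter> ?S \<noteq> {}"
    then obtain p b s t where p: "p \<in> P\<^sub>0" and b: "b \<in> carrier R"
      and s: "s \<in> A" "s \<notin> P\<^sub>0" and t: "t \<in> carrier R" "t \<notin> Q\<^sub>1" and eq: "b \<otimes> p = s \<otimes> t"
      unfolding cgenideal_def by auto
    have pA: "p \<in> A"
      using p P0A by blast
    \<comment> \<open>If \<open>p\<close> divided \<open>s\<close> in \<open>A\<close>, then
      \<open>s\<close> would lie in \<open>P\<^sub>0\<close>; so \<open>s\<close> divides
      \<open>p\<close>, and primality puts the cofactor into \<open>P\<^sub>0\<close>.\<close>
    have "\<not> (\<exists>c\<in>A. s = p \<otimes> c)"
      using P0.I_r_closed[OF p] s(2) by auto
    with total[OF pA s(1)] have "\<exists>c\<in>A. p = s \<otimes> c"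
      by argo
    then obtain c where c: "c \<in> A" "p = s \<otimes> c"
      by (rule bexE)
    then have cP: "c \<in> P\<^sub>0"
      using P0_prime[OF s(1) c(1)] s(2) p by simp
    have sR: "s \<in> carrier R" and cR: "c \<in> carrier R"
      using s(1) c(1) AR by auto
    have "s \<noteq> \<zero>"
      using s(2) zero_P0 by metis
    moreover have "s \<otimes> t = s \<otimes> (b \<otimes> c)"
      using eq m_lcomm[OF b sR cR] unfolding c(2) by (rule trans[OF sym])
    ultimately have tbc: "t = b \<otimes> c"
      using m_lcancel[OF _ sR t(1), of "b \<otimes> c"] b cR by simp
    have "c \<in> Q\<^sub>1"
      using cP sub P1 by auto
    then have "b \<otimes> c \<in> Q\<^sub>1"
      using b by (rule Q1.I_l_closed)
    with tbc t(2) show False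
      by simp
  qed
  ultimately obtain Q\<^sub>0 where Q0: "primeideal Q\<^sub>0 R" "?I \<subseteq> Q\<^sub>0" "Q\<^sub>0 \<inter> ?S = {}"
    using exists_primeideal_avoiding_submonoid by blast
  interpret Q0: primeideal Q\<^sub>0 R by fact
  \<comment> \<open>Take the first factor to be \<open>\<one>\<close>; for elements of
    \<open>A - P\<^sub>0\<close> below, take the second one to be \<open>\<one>\<close>.\<close>
  have "t \<in> ?S" if "t \<in> carrier R - Q\<^sub>1" for t
    using that A_one one_P0 by (intro CollectI exI[of _ \<one>] exI[of _ t]) auto
  then have "Q\<^sub>0 \<subseteq> Q\<^sub>1"
    using Q0(3) Q0.Icarr by blast
  moreover have "s \<in> ?S" if "s \<in> A - P\<^sub>0" for s
    using that one_Q1 AR by (intro CollectI exI[of _ s] exI[of _ \<one>]) auto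
  then have "Q\<^sub>0 \<inter> A \<subseteq> P\<^sub>0"
    using Q0(3) by blast
  moreover have "P\<^sub>0 \<subseteq> Q\<^sub>0"
    using Q0(2) cgenideal_self P0A AR by blast
  ultimately show "\<exists>Q\<^sub>0. primeideal Q\<^sub>0 R \<and> Q\<^sub>0 \<subseteq> Q\<^sub>1 \<and> Q\<^sub>0 \<inter> carrier (R\<lparr>carrier := A\<rparr>) = P\<^sub>0"
    using Q0(1) P0A by (intro exI[of _ Q\<^sub>0]) auto
qed

text \<open>For nonzero \<open>b\<close> the quotient of \<open>a\<close> by \<open>b\<close> works:
  \<open>v b\<close> is finite, so it cancels from \<open>v b \<le> v b + v c\<close>. For
  \<open>b = \<zero>\<close> the value of \<open>a\<close> is infinite, so \<open>a\<close> is zero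
  as well.\<close>

lemma (in valuation) nonneg_total_divides:
  assumes ab: "a \<in> carrier F" "b \<in> carrier F" and le: "v b \<le> v a"
  shows "\<exists>c\<in>carrier F. 0 \<le> v c \<and> a = b \<otimes> c"
proof (cases "b = \<zero>")
  case True
  then have "v a = PInf"
    using le v_inf_iff[of b] ab by (cases "v a") auto
  then have "a = b \<otimes> \<one>"
    using True v_inf_iff ab by simp
  then show ?thesis
    using v_one by force
next
  case False
  then have b: "b \<in> Units F"
    using ab field_Units by simp
  define c where "c = inv b \<otimes> a"
  have c: "c \<in> carrier F" "a = b \<otimes> c"
    using b ab unfolding c_def by (simp_all add: m_assoc[symmetric])
  moreover obtain \<beta> where "v b = Fin \<beta>"
    using False v_inf_iff ab by (cases "v b") auto
  then have "0 \<le> v c"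
    using le v_mult[of b c] c ab by (cases "v c") (auto simp: zero_with_inf_def)
  ultimately show ?thesis
    by blast
qed

theorem lemma4p12:
  fixes E :: "('a, 'b) ring_scheme"
    and F :: "'a set"
    and v :: "'a \<Rightarrow> 'g :: linordered_ab_group_add with_inf"
    and w :: "'a \<Rightarrow> 'm :: {linorder, ordered_comm_monoid_add} with_inf"
  assumes "field E"
    and "subfield F E"
    and "ring.finite_dimension E F (carrier E)"
    and "valuation (E\<lparr>carrier := F\<rparr>) v"
    and "quasi_valuation E w"
    and "extends_valuation (E\<lparr>carrier := F\<rparr>) v w"
  shows "going_down (nonneg_ring (E\<lparr>carrier := F\<rparr>) v) (nonneg_ring E w)"
proof -
  interpret field E by fact
  interpret F: valuation "E\<lparr>carrier := F\<rparr>" v by fact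
  interpret w: quasi_valuation E w by fact
  have FE: "F \<subseteq> carrier E" and subring: "subring F E"
    using subfieldE[OF assms(2)] subcring.axioms(1) by auto
  have nonneg_iff: "0 \<le> w x \<longleftrightarrow> 0 \<le> v x" if "x \<in> F" for x
    using extends_valuation_nonneg_iff[OF assms(4,6)] that by simp
  \<comment> \<open>Additive inverses are defined relative to the carrier, so agreement with those
    of \<open>E\<close> comes from uniqueness of inverses.\<close>
  have minus_one: "\<ominus>\<^bsub>E\<lparr>carrier := F\<rparr>\<^esub> \<one>\<^bsub>E\<^esub> = \<ominus>\<^bsub>E\<^esub> \<one>\<^bsub>E\<^esub>"
    using F.minus_equality[of "\<ominus>\<^bsub>E\<^esub> \<one>\<^bsub>E\<^esub>" "\<one>\<^bsub>E\<^esub>"] subringE(3,5)[OF subring] by (simp add: l_neg)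
  obtain \<iota> where \<iota>: "\<iota> 0 = 0" "\<And>x. x \<in> F \<Longrightarrow> w x = map_with_inf \<iota> (v x)"
    using assms(6) unfolding extends_valuation_def by auto
  \<comment> \<open>These two values come from \<open>v\<close> through
    \<open>\<iota> 0 = 0\<close>; they give \<open>B\<close> its unit and its closure under
    negation.\<close>
  have "w \<one>\<^bsub>E\<^esub> = 0" "w (\<ominus>\<^bsub>E\<^esub> \<one>\<^bsub>E\<^esub>) = 0"
    using \<iota> F.v_one F.v_minus_one subringE(3,5)[OF subring]
    by (simp_all add: minus_one zero_with_inf_def)
  then have "subring (carrier (nonneg_ring E w)) E"
    by (rule w.subring_nonneg)
  moreover define B where "B = nonneg_ring E w"
  ultimately have W: "subring (carrier B) E"
    by simp
  define V where "V = {x \<in> F. 0 \<le> v x}"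
  have B_eq: "B = E\<lparr>carrier := carrier B\<rparr>"
    by (simp add: B_def nonneg_ring_def)
  interpret B: domain B
    by (subst B_eq) (rule subring_is_domain[OF W])
  \<comment> \<open>On \<open>F\<close> nonnegativity of \<open>w\<close> and of \<open>v\<close>
    coincide, so closure of \<open>V\<close> follows from closure of \<open>F\<close> and of
    \<open>carrier B\<close>.\<close>
  have V_eq: "V = F \<inter> carrier B"
    using nonneg_iff FE by (auto simp: V_def B_def nonneg_ring_def)
  have ops: "\<zero>\<^bsub>B\<^esub> = \<zero>\<^bsub>E\<^esub>" "\<one>\<^bsub>B\<^esub> = \<one>\<^bsub>E\<^esub>" "(\<otimes>\<^bsub>B\<^esub>) = (\<otimes>\<^bsub>E\<^esub>)" "(\<oplus>\<^bsub>B\<^esub>) = (\<oplus>\<^bsub>E\<^esub>)"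
    by (simp_all add: B_def nonneg_ring_def)
  have minus: "\<ominus>\<^bsub>B\<^esub> x = \<ominus>\<^bsub>E\<^esub> x" if "x \<in> carrier B" for x
    using B.minus_equality[of "\<ominus>\<^bsub>E\<^esub> x" x] that subringE(5)[OF W that] subringE(1)[OF W]
    by (simp add: ops l_neg subset_iff)
  have "subring V B"
  proof (rule B.subringI)
    show "V \<subseteq> carrier B" "\<one>\<^bsub>B\<^esub> \<in> V"
      using V_eq subringE(3)[OF subring] B.one_closed by (auto simp: ops)
    show "\<ominus>\<^bsub>B\<^esub> x \<in> V" if "x \<in> V" for x
      using that subringE(5)[OF subring, of x] B.a_inv_closed[of x] minus[of x] V_eq by simp
    show "x \<otimes>\<^bsub>B\<^esub> y \<in> V" "x \<oplus>\<^bsub>B\<^esub> y \<in> V" if "x \<in> V" "y \<in> V" for x y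
      using that subringE(6,7)[OF subring, of x y] B.m_closed[of x y] B.a_closed[of x y] V_eq
      by (simp_all add: ops)
  qed
  \<comment> \<open>Values are linearly ordered, and the element of smaller value divides the other
    with a cofactor of nonnegative value.\<close>
  moreover have "(\<exists>c\<in>V. a = b \<otimes>\<^bsub>B\<^esub> c) \<or> (\<exists>c\<in>V. b = a \<otimes>\<^bsub>B\<^esub> c)" if "a \<in> V" "b \<in> V" for a b
    using F.nonneg_total_divides[of a b] F.nonneg_total_divides[of b a] that linear[of "v a" "v b"]
    by (auto simp: V_def ops)
  ultimately have "going_down (B\<lparr>carrier := V\<rparr>) B"
    by (rule B.going_down_of_total_divides)
  then show ?thesis
    by (simp add: B_def V_def nonneg_ring_def)
qed

end
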